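(* Let $(\Omega,\mu,d)$ be a metric measure space satisfying the standing assumptions with $\mu(\Omega)=\infty$, and let $w$ be a weight on $\Omega$ such that, for some constant $c$, $$\|f\|_{L^1(\Omega)}^2\le c\,\big\||\nabla f|\big\|_{L^1(\Omega)}\,\|wf\|_{L^1(\Omega)}$$ holds for all $f\in Lip_0(\Omega)$. If $\mu(\{w\le t\})<\infty$, then $$\mu(\{w\le t\})\le c\,t\,\mu^+(\{w\le t\}).$$
   Context: Setting and standing assumptions. $(\Omega,\mu,d)$ is a connected metric space with a Borel measure $\mu$ such that $\mu(K)<\infty$ for every compact $K\subset\Omega$, and here $\mu(\Omega)=\infty$. $Lip_0(\Omega)$ is the set of real-valued Lipschitz functions on $\Omega$ with compact support. For such $f$, $|\nabla f(x)|=\limsup_{d(x,y)\to0}\frac{|f(x)-f(y)|}{d(x,y)}$. For a Borel set $A\subset\Omega$, $\mu^+(A)=\liminf_{h\to0}\frac{\mu(A_h)-\mu(A)}{h}$, where $A_h=\{x\in\Omega:d(x,A)<h\}$. The isoperimetric profile $I(t)=\inf\{\mu^+(A):\mu(A)=t\}$, $t\in[0,\infty)$, is assumed to be concave, continuous, increasing, with $I(0)=0$. A weight is a locally integrable function $w:\Omega\to\mathbb{R}_+$ with $w>0$ a.e.; $t>0$ is arbitrary.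
   Formalization: The formal theorem additionally assumes that closed balls of Ω are compact; without it the claim fails, e.g. on the open half-plane with Lebesgue measure, where compactly supported Lipschitz functions must vanish near the edge although the edge does not count in μ⁺. *)

theory Defs
  imports "HOL-Analysis.Analysis"
begin

definition Lip0 :: "('a::metric_space \<Rightarrow> real) set" where
  "Lip0 = {f. (\<exists>L. L-lipschitz_on UNIV f) \<and> compact (closure {x. f x \<noteq> 0})}"

definition grad_norm :: "('a::metric_space \<Rightarrow> real) \<Rightarrow> 'a \<Rightarrow> ennreal" where
  "grad_norm f x = Limsup (at x) (\<lambda>y. ennreal (\<bar>f x - f y\<bar> / dist x y))"

definition L1_norm :: "'a measure \<Rightarrow> ('a \<Rightarrow> ennreal) \<Rightarrow> ennreal" where
  "L1_norm M g = (\<integral>\<^sup>+x. g x \<partial>M)"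

(* Equals {x. infdist x A < h} for nonempty A; for A = {} it is empty, whereas
   infdist x {} = 0 would make the enlargement of {} the whole space. *)
definition enlargement :: "real \<Rightarrow> 'a::metric_space set \<Rightarrow> 'a set" where
  "enlargement h A = {x. \<exists>a\<in>A. dist x a < h}"

(* Only meaningful for sets of finite measure (ennreal subtraction). *)
definition minkowski_content :: "'a::metric_space measure \<Rightarrow> 'a set \<Rightarrow> ennreal" where
  "minkowski_content M A =
     Liminf (at_right 0) (\<lambda>h. (emeasure M (enlargement h A) - emeasure M A) / ennreal h)"

definition isop_profile :: "'a::metric_space measure \<Rightarrow> real \<Rightarrow> ennreal" where
  "isop_profile M t =
     Inf {minkowski_content M A |A. A \<in> sets borel \<and> emeasure M A = ennreal t}"

(* A concave profile that vanishes and is continuous at 0 cannot take the value infinity,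
   so finiteness is part of the assumption and the rest can be said for real functions. *)
definition standard_profile :: "(real \<Rightarrow> ennreal) \<Rightarrow> bool" where
  "standard_profile I \<longleftrightarrow>
     (\<forall>t\<ge>0. I t < \<infinity>) \<and>
     concave_on {0..} (\<lambda>t. enn2real (I t)) \<and>
     continuous_on {0..} (\<lambda>t. enn2real (I t)) \<and>
     mono_on {0..} (\<lambda>t. enn2real (I t)) \<and>
     I 0 = 0"

definition weight :: "'a::metric_space measure \<Rightarrow> ('a \<Rightarrow> real) \<Rightarrow> bool" where
  "weight M w \<longleftrightarrow>
     w \<in> borel_measurable M \<and> (\<forall>x. 0 \<le> w x) \<and> (AE x in M. 0 < w x) \<and>
     (\<forall>K. compact K \<longrightarrow> set_integrable M K w)"

end

theory Submission
  imports Defs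
begin

text \<open>Let \<open>A\<close> be the level set. Test the inequality with the minimum of a collar function, equal to
  1 near \<open>A\<close> and vanishing off the \<open>h\<close>-enlargement with slope about \<open>1 / h\<close>, and a cone of slope
  \<open>1 / R\<close>, which supplies compact support. If the Minkowski content of \<open>A\<close> is finite, the boundary
  part of the closure of \<open>A\<close> is null, so letting \<open>h\<close> tend to 0 along a minimising sequence leaves
  \<open>w \<le> t\<close> on the support of the right-hand side; one factor \<open>\<integral>\<^sub>A cone\<close> cancels, and \<open>R\<close> tends to
  infinity. If the content is infinite, only \<open>c \<noteq> 0\<close> is needed, because \<open>0 * \<infinity> = 0\<close>.\<close>

section \<open>Enlargements of a set and their intersection\<close>

lemma enlargement_iff_infdist:
  assumes "A \<noteq> {}"
  shows "x \<in> enlargement h A \<longleftrightarrow> infdist x A < h"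
  using assms unfolding enlargement_def infdist_def by (auto simp: cINF_less_iff)

lemma enlargement_eq_Union_ball: "enlargement h A = (\<Union>a\<in>A. ball a h)"
  unfolding enlargement_def by (auto simp: dist_commute)

lemma open_enlargement: "open (enlargement h A)"
  unfolding enlargement_eq_Union_ball by auto

lemma enlargement_mono: "h \<le> h' \<Longrightarrow> enlargement h A \<subseteq> enlargement h' A"
  unfolding enlargement_def by force

lemma subset_enlargement: "0 < h \<Longrightarrow> A \<subseteq> enlargement h A"
  unfolding enlargement_def by force

lemma closure_subset_enlargement: "0 < h \<Longrightarrow> closure A \<subseteq> enlargement h A"
  unfolding enlargement_def by (auto simp: closure_approachable dist_commute)

text \<open>Countably many radii suffice for reaching the closure, so continuity from above of a
  measure can be applied to the enlargements.\<close>

lemma Inter_enlargement: "(\<Inter>j. enlargement (1 / real (Suc j)) A) = closure A"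
proof
  show "closure A \<subseteq> (\<Inter>j. enlargement (1 / real (Suc j)) A)"
    by (intro INT_greatest closure_subset_enlargement) simp
  show "(\<Inter>j. enlargement (1 / real (Suc j)) A) \<subseteq> closure A"
  proof
    fix x assume x: "x \<in> (\<Inter>j. enlargement (1 / real (Suc j)) A)"
    show "x \<in> closure A"
      unfolding closure_approachable
    proof (intro allI impI)
      fix e :: real assume "0 < e"
      then obtain j where j: "1 / real (Suc j) < e"
        using nat_approx_posE by blast
      from x obtain a where "a \<in> A" "dist x a < 1 / real (Suc j)"
        unfolding enlargement_def by blast
      with j show "\<exists>y\<in>A. dist y x < e"
        by (auto simp: dist_commute intro!: bexI[of _ a])
    qed
  qed
qed

section \<open>Test functions built from a collar and a cone, with pointwise gradient bounds\<close>

lemma grad_norm_le: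
  assumes "\<forall>\<^sub>F y in at x. \<bar>f x - f y\<bar> \<le> L * dist x y"
  shows "grad_norm f x \<le> ennreal L"
  unfolding grad_norm_def
proof (rule Limsup_bounded)
  show "\<forall>\<^sub>F y in at x. ennreal (\<bar>f x - f y\<bar> / dist x y) \<le> ennreal L"
    using assms eventually_neq_at_within[of x x UNIV]
    by eventually_elim (intro ennreal_leI, auto simp: field_simps)
qed

text \<open>Adding the two errors costs nothing in the end: the second one will carry the slope
  \<open>1 / R\<close> of the cone, which vanishes as \<open>R\<close> tends to infinity.\<close>

lemma abs_min_diff_le:
  fixes u v u' v' s t :: real
  assumes "\<bar>u - u'\<bar> \<le> s" "\<bar>v - v'\<bar> \<le> t"
  shows "\<bar>min u v - min u' v'\<bar> \<le> s + t"
  using assms by linarith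

lemma abs_clamp_diff_le:
  fixes u v :: real
  shows "\<bar>max 0 (min 1 u) - max 0 (min 1 v)\<bar> \<le> \<bar>u - v\<bar>"
  by linarith

definition cone :: "'a::metric_space \<Rightarrow> real \<Rightarrow> 'a \<Rightarrow> real" where
  "cone p R x = max 0 (1 - dist x p / R)"

definition collar :: "real \<Rightarrow> real \<Rightarrow> 'a::metric_space set \<Rightarrow> 'a \<Rightarrow> real" where
  "collar a b A x = max 0 (min 1 ((b - infdist x A) / (b - a)))"

lemma cone_bounds: "0 \<le> cone p R x" "0 < R \<Longrightarrow> cone p R x \<le> 1"
  by (auto simp: cone_def)

lemma cone_eq_0: "0 < R \<Longrightarrow> x \<notin> cball p R \<Longrightarrow> cone p R x = 0"
  by (auto simp: cone_def field_simps dist_commute)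

lemma abs_diff_cone_le:
  assumes "0 < R"
  shows "\<bar>cone p R x - cone p R y\<bar> \<le> 1 / R * dist x y"
proof -
  have "\<bar>dist x p - dist y p\<bar> \<le> dist x y"
    using abs_dist_diff_le by (metis dist_commute)
  then have "\<bar>dist x p - dist y p\<bar> / R \<le> dist x y / R"
    using assms by (intro divide_right_mono) auto
  then have "\<bar>dist x p / R - dist y p / R\<bar> \<le> 1 / R * dist x y"
    using assms by (simp add: abs_divide flip: diff_divide_distrib)
  then show ?thesis unfolding cone_def by linarith
qed

lemma collar_bounds: "0 \<le> collar a b A x" "collar a b A x \<le> 1"
  by (auto simp: collar_def)

lemma abs_diff_collar_le:
  assumes "a < b"
  shows "\<bar>collar a b A x - collar a b A y\<bar> \<le> 1 / (b - a) * dist x y"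
proof -
  have "\<bar>infdist x A - infdist y A\<bar> \<le> dist x y"
    by (rule infdist_triangle_abs)
  then have "\<bar>infdist y A - infdist x A\<bar> / (b - a) \<le> dist x y / (b - a)"
    using assms by (intro divide_right_mono) auto
  then have "\<bar>(b - infdist x A) / (b - a) - (b - infdist y A) / (b - a)\<bar> \<le> 1 / (b - a) * dist x y"
    using assms by (simp add: abs_divide flip: diff_divide_distrib)
  then show ?thesis unfolding collar_def by (rule order_trans[OF abs_clamp_diff_le])
qed

lemma collar_eq_1: "a < b \<Longrightarrow> infdist x A \<le> a \<Longrightarrow> collar a b A x = 1"
  by (simp add: collar_def le_divide_eq)

lemma collar_eq_0: "a < b \<Longrightarrow> b \<le> infdist x A \<Longrightarrow> collar a b A x = 0"
  by (simp add: collar_def divide_nonpos_pos min.coboundedI2)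

text \<open>The set \<open>A\<close> may be unbounded, so compactness of the support comes from the
  cone alone: it vanishes off \<open>cball p R\<close>, which is compact. The two slopes add up to a
  global Lipschitz constant.\<close>

lemma min_collar_cone_Lip0:
  assumes "\<And>r. compact (cball p r)" "0 < R" "a < b"
  shows "(\<lambda>x. min (collar a b A x) (cone p R x)) \<in> Lip0"
  unfolding Lip0_def
proof (intro CollectI conjI exI)
  show "(1 / (b - a) + 1 / R)-lipschitz_on UNIV (\<lambda>x. min (collar a b A x) (cone p R x))"
  proof (rule lipschitz_onI)
    fix x y :: 'a
    show "dist (min (collar a b A x) (cone p R x)) (min (collar a b A y) (cone p R y))
        \<le> (1 / (b - a) + 1 / R) * dist x y"
      unfolding dist_real_def distrib_right
      by (intro abs_min_diff_le abs_diff_cone_le[OF assms(2)] abs_diff_collar_le[OF assms(3)])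
  next
    show "0 \<le> 1 / (b - a) + 1 / R" using assms by (intro add_nonneg_nonneg) auto
  qed
  have "{x. min (collar a b A x) (cone p R x) \<noteq> 0} \<subseteq> cball p R"
  proof (rule subsetI, rule ccontr)
    fix x assume x: "x \<in> {x. min (collar a b A x) (cone p R x) \<noteq> 0}" "x \<notin> cball p R"
    show False
      using x(1) cone_eq_0[OF assms(2) x(2)] collar_bounds(1)[of a b A x] by simp
  qed
  then have "closure {x. min (collar a b A x) (cone p R x) \<noteq> 0} \<subseteq> cball p R"
    by (simp add: closure_minimal)
  then have "cball p R \<inter> closure {x. min (collar a b A x) (cone p R x) \<noteq> 0}
      = closure {x. min (collar a b A x) (cone p R x) \<noteq> 0}"
    by (rule inf.absorb2)
  then show "compact (closure {x. min (collar a b A x) (cone p R x) \<noteq> 0})"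
    using compact_Int_closed[OF assms(1)[of R] closed_closure] by (rule subst)
qed

text \<open>Taking \<open>0 < a\<close> and \<open>b < h\<close> makes the collar locally constant on \<open>A\<close> and off the
  \<open>h\<close>-enlargement, so its gradient vanishes there even at boundary points.\<close>
lemma grad_norm_min_collar_cone_le:
  assumes "A \<noteq> {}" "0 < R" "0 < a" "a < b" "b < h"
  shows "grad_norm (\<lambda>x. min (collar a b A x) (cone p R x)) x
    \<le> ennreal (1 / (b - a)) * indicator (enlargement h A - A) x
      + ennreal (1 / R) * indicator (enlargement h A) x"
proof -
  let ?f = "\<lambda>x. min (collar a b A x) (cone p R x)"
  note cone = abs_diff_cone_le[OF assms(2), of p] and collar = abs_diff_collar_le[OF assms(4), of A]
  consider "x \<in> A" | "x \<in> enlargement h A - A" | "x \<notin> enlargement h A" by blast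
  then show ?thesis
  proof cases
    case 1
    have "\<forall>\<^sub>F y in at x. \<bar>?f x - ?f y\<bar> \<le> 1 / R * dist x y"
      unfolding eventually_at
    proof (intro exI[of _ a] conjI ballI impI)
      fix y assume y: "y \<noteq> x \<and> dist y x < a"
      have "infdist x A \<le> a" "infdist y A \<le> a"
        using 1 y assms(3) infdist_le[OF 1, of y] by auto
      then have "collar a b A x = 1" "collar a b A y = 1"
        using collar_eq_1[OF assms(4)] by blast+
      then show "\<bar>?f x - ?f y\<bar> \<le> 1 / R * dist x y"
        using cone[of x y] cone_bounds(2)[OF assms(2), of p x] cone_bounds(2)[OF assms(2), of p y]
        by simp
    qed (use assms in simp)
    then have "grad_norm ?f x \<le> ennreal (1 / R)" by (rule grad_norm_le)
    moreover have "x \<in> enlargement h A" using 1 assms subset_enlargement[of h A] by auto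
    ultimately show ?thesis using 1 by simp
  next
    case 2
    have "\<forall>\<^sub>F y in at x. \<bar>?f x - ?f y\<bar> \<le> (1 / (b - a) + 1 / R) * dist x y"
    proof (rule always_eventually, rule allI)
      fix y
      show "\<bar>?f x - ?f y\<bar> \<le> (1 / (b - a) + 1 / R) * dist x y"
        unfolding distrib_right by (intro abs_min_diff_le cone collar)
    qed
    then have "grad_norm ?f x \<le> ennreal (1 / (b - a) + 1 / R)" by (rule grad_norm_le)
    then show ?thesis using 2 assms by (simp add: ennreal_plus)
  next
    case 3
    then have x: "h \<le> infdist x A" using enlargement_iff_infdist[OF assms(1)] by (simp add: not_less)
    have "\<forall>\<^sub>F y in at x. \<bar>?f x - ?f y\<bar> \<le> 0 * dist x y"
      unfolding eventually_at
    \<comment> \<open>By the triangle inequality, points within \<open>h - b\<close> of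
      \<open>x\<close> keep distance at least \<open>b\<close> from \<open>A\<close>, where the
      collar and hence the minimum vanish.\<close>
    proof (intro exI[of _ "h - b"] conjI ballI impI)
      fix y assume y: "y \<noteq> x \<and> dist y x < h - b"
      have "b \<le> infdist x A" "b \<le> infdist y A"
        using x y assms infdist_triangle[of x A y] by (auto simp: dist_commute)
      then have "collar a b A x = 0" "collar a b A y = 0"
        using collar_eq_0[OF assms(4)] by blast+
      then show "\<bar>?f x - ?f y\<bar> \<le> 0 * dist x y"
        using cone_bounds(1)[of p R] by (simp add: min_def)
    qed (use assms in simp)
    then have "grad_norm ?f x \<le> ennreal 0" by (rule grad_norm_le)
    then show ?thesis by simp
  qed
qed

section \<open>Consequences of a finite Minkowski content\<close>

text \<open>A lower limit controls the quotient only for some arbitrarily small \<open>h\<close>,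
  not for all of them. The later estimates therefore work with one \<open>h\<close> at a
  time.\<close>

lemma ex_quotient_less:
  assumes "minkowski_content M A < y" "0 < e"
  shows "\<exists>h. 0 < h \<and> h < e \<and> (emeasure M (enlargement h A) - emeasure M A) / ennreal h < y"
proof (rule ccontr)
  assume contra: "\<not> ?thesis"
  have "\<forall>\<^sub>F h in at_right 0. y \<le> (emeasure M (enlargement h A) - emeasure M A) / ennreal h"
    using eventually_at_right_real[OF \<open>0 < e\<close>]
    by eventually_elim (use contra in force)
  then have "y \<le> minkowski_content M A"
    unfolding minkowski_content_def by (rule Liminf_bounded)
  with assms show False by simp
qed

lemma emeasure_enlargement_Diff:
  assumes "sets M = sets borel" "A \<in> sets M" "emeasure M A < \<infinity>" "0 < h"
  shows "emeasure M (enlargement h A - A) = emeasure M (enlargement h A) - emeasure M A"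
  using assms open_enlargement[of h A] subset_enlargement[of h A] by (intro emeasure_Diff) auto

text \<open>The set \<open>closure A - A\<close> lies in every shell
  \<open>enlargement h A - A\<close>, whose measure is \<open>h\<close> times the difference
  quotient. Along suitable \<open>h\<close> tending to 0 the quotient stays below
  \<open>m + 1\<close>, so the product tends to 0.\<close>

lemma emeasure_closure_diff_eq_0:
  assumes M: "sets M = sets borel" and A: "A \<in> sets M" "emeasure M A < \<infinity>"
    and fin: "minkowski_content M A < \<infinity>"
  shows "emeasure M (closure A - A) = 0"
proof -
  obtain m where m: "minkowski_content M A = ennreal m" "0 \<le> m"
    using fin by (cases "minkowski_content M A") auto
  have "emeasure M (closure A - A) \<le> ennreal e" if e: "0 < e" for e
  proof -
    have "minkowski_content M A < ennreal (m + 1)" using m by (simp add: ennreal_less_iff)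
    moreover have "0 < e / (m + 1)" using m e by simp
    ultimately obtain h where h: "0 < h" "h < e / (m + 1)"
      and q: "(emeasure M (enlargement h A) - emeasure M A) / ennreal h < ennreal (m + 1)"
      using ex_quotient_less by blast
    have "emeasure M (closure A - A) \<le> emeasure M (enlargement h A - A)"
      using closure_subset_enlargement[OF h(1), of A] A open_enlargement[of h A] M
      by (intro emeasure_mono) auto
    \<comment> \<open>Dividing and multiplying by \<open>ennreal h\<close> cancels because
      \<open>h\<close> is positive and finite.\<close>
    also have "\<dots> = (emeasure M (enlargement h A) - emeasure M A) / ennreal h * ennreal h"
      using h emeasure_enlargement_Diff[OF M A h(1)]
      by (simp add: ennreal_divide_times ennreal_times_divide mult_divide_eq_ennreal)
    also have "\<dots> \<le> ennreal (m + 1) * ennreal h"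
      using q by (intro mult_right_mono) auto
    also have "\<dots> = ennreal ((m + 1) * h)"
      using h m by (intro ennreal_mult[symmetric]) auto
    also have "\<dots> \<le> ennreal e"
      using h m by (intro ennreal_leI) (simp add: field_simps)
    finally show ?thesis .
  qed
  then show ?thesis
    using ennreal_le_epsilon[of 0 "emeasure M (closure A - A)"] by (metis add_0 le_zero_eq)
qed

section \<open>Exhaustion of the space by cones of growing radius\<close>

lemma incseq_cone: "incseq (\<lambda>n. cone p (real (Suc n)) x)"
proof (rule incseq_SucI)
  fix n
  have "dist x p / real (Suc (Suc n)) \<le> dist x p / real (Suc n)"
    by (intro divide_left_mono) auto
  then show "cone p (real (Suc n)) x \<le> cone p (real (Suc (Suc n))) x"
    unfolding cone_def by linarith
qed

lemma cone_tendsto_1: "(\<lambda>n. cone p (real (Suc n)) x) \<longlonglongrightarrow> 1"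
proof -
  have "(\<lambda>n. dist x p / real (Suc n)) \<longlonglongrightarrow> 0"
    using LIMSEQ_Suc[OF lim_const_over_n] by simp
  from tendsto_max[OF tendsto_const[of 0] tendsto_diff[OF tendsto_const[of 1] this]]
  show ?thesis unfolding cone_def by simp
qed

lemma continuous_on_cone:
  assumes "0 < R"
  shows "continuous_on UNIV (cone p R)"
  unfolding cone_def using assms by (intro continuous_intros) auto

lemma borel_measurable_cone:
  assumes "sets M = sets borel" "0 < R"
  shows "cone p R \<in> borel_measurable M"
  using borel_measurable_continuous_onI[OF continuous_on_cone[OF assms(2)]] assms(1)
  by (simp cong: measurable_cong_sets)

text \<open>Monotone convergence. The radii start at 1: with radius 0 the convention
  \<open>x / 0 = 0\<close> would make the cone constantly 1 and destroy monotonicity.\<close>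

lemma nn_integral_cone_tendsto:
  assumes M: "sets M = sets borel" and A: "A \<in> sets M"
  shows "(\<lambda>n. \<integral>\<^sup>+x. ennreal (cone p (real (Suc n)) x) * indicator A x \<partial>M) \<longlonglongrightarrow> emeasure M A"
proof -
  have [measurable]: "cone p (real (Suc n)) \<in> borel_measurable M" for n
    by (intro borel_measurable_cone M) simp
  note A[measurable]
  have "(\<lambda>n. \<integral>\<^sup>+x. ennreal (cone p (real (Suc n)) x) * indicator A x \<partial>M)
      \<longlonglongrightarrow> (\<integral>\<^sup>+x. indicator A x \<partial>M)"
  proof (rule nn_integral_LIMSEQ)
    show "incseq (\<lambda>n x. ennreal (cone p (real (Suc n)) x) * indicator A x)"
      using incseq_cone[of p] by (auto simp: incseq_def le_fun_def intro!: mult_right_mono ennreal_leI)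
    show "(\<lambda>n. ennreal (cone p (real (Suc n)) x) * indicator A x) \<longlonglongrightarrow> indicator A x" for x
      using tendsto_ennrealI[OF cone_tendsto_1[of p x]] by (cases "x \<in> A") auto
  qed measurable
  then show ?thesis by simp
qed

section \<open>The inequality for the test functions and its limit as \<open>h\<close> tends to
  0\<close>

text \<open>The shell has measure \<open>h * q\<close> and the collar has slope
  \<open>k / h\<close>, which gives \<open>k * q\<close>; the cone contributes \<open>1 / R\<close>
  on the whole enlargement. In the weighted norm \<open>w\<close> is at most \<open>t\<close> on
  \<open>A\<close>, and the uncontrolled values of \<open>w\<close> on the shell are collected in
  \<open>E\<close>. The factor \<open>k > 1\<close> pays for the margins of the collar.\<close>

lemma uncertainty_collar_estimate:
  fixes M :: "'a::metric_space measure"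
  assumes M: "sets M = sets borel"
    and proper: "\<And>r. compact (cball p r)"
    and A: "A \<in> sets M" "emeasure M A < \<infinity>" "A \<noteq> {}"
    and w: "w \<in> borel_measurable M" "\<And>x. 0 \<le> w x" "\<And>x. x \<in> A \<Longrightarrow> w x \<le> t"
    and uncertainty: "\<And>f. f \<in> Lip0 \<Longrightarrow>
           (L1_norm M (\<lambda>x. ennreal \<bar>f x\<bar>))\<^sup>2
             \<le> ennreal c * L1_norm M (grad_norm f) * L1_norm M (\<lambda>x. ennreal \<bar>w x * f x\<bar>)"
    and R: "0 < R" and k: "1 < k" and h: "0 < h"
  defines "P \<equiv> \<integral>\<^sup>+x. ennreal (cone p R x) * indicator A x \<partial>M"
    and "q \<equiv> (emeasure M (enlargement h A) - emeasure M A) / ennreal h"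
    and "E \<equiv> \<integral>\<^sup>+x. ennreal (w x * cone p R x) * indicator (enlargement h A - A) x \<partial>M"
  shows "P\<^sup>2 \<le> ennreal c * (ennreal k * q + ennreal (1 / R) * (emeasure M A + ennreal h * q))
    * (ennreal t * P + E)"
proof -
  \<comment> \<open>Equal margins of width \<open>a\<close> on both sides leave
    \<open>b - a = h / k\<close>, hence the slope \<open>k / h\<close>; \<open>k > 1\<close> makes
    \<open>a\<close> positive.\<close>
  define a b where "a = h * (1 - 1 / k) / 2" and "b = h - a"
  have ab: "0 < a" "a < b" "b < h" "1 / (b - a) = k / h"
    using h k by (auto simp: a_def b_def field_simps)
  define f where "f = (\<lambda>x. min (collar a b A x) (cone p R x))"
  have f_nonneg: "0 \<le> f x" for x
    using collar_bounds(1)[of a b A x] cone_bounds(1)[of p R x] by (simp add: f_def)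
  have f_eq_cone: "f x = cone p R x" if "x \<in> A" for x
    using collar_eq_1[OF ab(2), of x A] cone_bounds(2)[OF R, of p x] that ab(1) by (simp add: f_def)
  have f_le_cone: "f x \<le> cone p R x" for x by (simp add: f_def)
  have f_eq_0: "f x = 0" if "x \<notin> enlargement h A" for x
    using collar_eq_0[OF ab(2), of x A] enlargement_iff_infdist[OF A(3), of x h] that ab(3)
      cone_bounds(1)[of p R x] by (simp add: f_def)
  note [measurable] = borel_measurable_cone[OF M R, of p] A(1) w(1)
  have [measurable]: "enlargement h A \<in> sets M" using open_enlargement[of h A] M by auto
  have AS: "A \<subseteq> enlargement h A" by (rule subset_enlargement[OF h])
  have "P \<le> L1_norm M (\<lambda>x. ennreal \<bar>f x\<bar>)"
    unfolding P_def L1_norm_def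
    by (intro nn_integral_mono) (auto simp: f_eq_cone indicator_def cone_bounds)
  then have "P\<^sup>2 \<le> (L1_norm M (\<lambda>x. ennreal \<bar>f x\<bar>))\<^sup>2"
    by (rule power_mono) simp
  also have "\<dots> \<le> ennreal c * L1_norm M (grad_norm f) * L1_norm M (\<lambda>x. ennreal \<bar>w x * f x\<bar>)"
    using min_collar_cone_Lip0[OF proper R ab(2)] unfolding f_def by (rule uncertainty)
  also have "\<dots> \<le> ennreal c * (ennreal k * q + ennreal (1 / R) * (emeasure M A + ennreal h * q))
    * (ennreal t * P + E)"
  proof (intro mult_mono order_refl)
    have "L1_norm M (grad_norm f)
        \<le> (\<integral>\<^sup>+x. ennreal (1 / (b - a)) * indicator (enlargement h A - A) x
              + ennreal (1 / R) * indicator (enlargement h A) x \<partial>M)"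
      unfolding L1_norm_def f_def
      by (intro nn_integral_mono grad_norm_min_collar_cone_le A R ab)
    also have "\<dots> = ennreal (k / h) * emeasure M (enlargement h A - A)
        + ennreal (1 / R) * emeasure M (enlargement h A)"
      by (subst nn_integral_add) (auto simp: nn_integral_cmult_indicator ab(4))
    also have "ennreal (k / h) * emeasure M (enlargement h A - A) = ennreal k * q"
      using h k unfolding emeasure_enlargement_Diff[OF M A(1,2) h] q_def
      by (simp add: divide_ennreal[symmetric] ennreal_divide_times ennreal_times_divide)
    also have "emeasure M (enlargement h A) = emeasure M A + emeasure M (enlargement h A - A)"
      using emeasure_Un[of A M "enlargement h A"] AS by (simp add: Un_absorb1)
    also have "emeasure M (enlargement h A - A) = ennreal h * q"
      using h unfolding emeasure_enlargement_Diff[OF M A(1,2) h] q_def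
      by (simp add: ennreal_times_divide mult_divide_eq_ennreal mult.commute[of "ennreal h"])
    finally show "L1_norm M (grad_norm f)
        \<le> ennreal k * q + ennreal (1 / R) * (emeasure M A + ennreal h * q)" .
    have "L1_norm M (\<lambda>x. ennreal \<bar>w x * f x\<bar>)
        \<le> (\<integral>\<^sup>+x. ennreal t * (ennreal (cone p R x) * indicator A x)
              + ennreal (w x * cone p R x) * indicator (enlargement h A - A) x \<partial>M)"
      unfolding L1_norm_def
    proof (rule nn_integral_mono)
      fix x
      consider "x \<in> A" | "x \<in> enlargement h A - A" | "x \<notin> enlargement h A" by blast
      then show "ennreal \<bar>w x * f x\<bar> \<le> ennreal t * (ennreal (cone p R x) * indicator A x)
              + ennreal (w x * cone p R x) * indicator (enlargement h A - A) x"
      proof cases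
        case 1
        have "0 \<le> t" using w(2)[of x] w(3)[OF 1] by linarith
        with 1 have "ennreal \<bar>w x * f x\<bar> \<le> ennreal (t * cone p R x)"
          using w(2)[of x] w(3)[OF 1] cone_bounds(1)[of p R x]
          by (intro ennreal_leI) (auto simp: f_eq_cone abs_mult intro!: mult_right_mono)
        also have "\<dots> = ennreal t * ennreal (cone p R x)"
          using \<open>0 \<le> t\<close> cone_bounds(1)[of p R x] by (rule ennreal_mult)
        finally show ?thesis using 1 by simp
      next
        case 2
        then have "\<bar>w x * f x\<bar> \<le> w x * cone p R x"
          using w(2)[of x] f_nonneg[of x] f_le_cone[of x] by (auto simp: abs_mult intro!: mult_left_mono)
        then show ?thesis using 2 by (auto intro: ennreal_leI)
      next
        case 3
        then show ?thesis by (simp add: f_eq_0)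
      qed
    qed
    also have "\<dots> = ennreal t * P + E"
      unfolding P_def E_def by (subst nn_integral_add) (auto simp: nn_integral_cmult)
    finally show "L1_norm M (\<lambda>x. ennreal \<bar>w x * f x\<bar>) \<le> ennreal t * P + E" .
  qed auto
  finally show ?thesis .
qed

text \<open>The measure \<open>density M g\<close> is finite, and the shells decrease to the null
  set \<open>closure A - A\<close>, so continuity from above applies. The bound holds for every
  \<open>h\<close> below the threshold and can thus be combined with an \<open>h\<close> supplied by
  \<open>ex_quotient_less\<close>.\<close>

lemma ex_nn_integral_enlargement_less:
  assumes M: "sets M = sets borel" and A: "A \<in> sets M" "emeasure M (closure A - A) = 0"
    and g: "g \<in> borel_measurable M" "(\<integral>\<^sup>+x. g x \<partial>M) < \<infinity>" and e: "0 < e"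
  shows "\<exists>\<eta>>0. \<forall>h\<le>\<eta>. (\<integral>\<^sup>+x. g x * indicator (enlargement h A - A) x \<partial>M) < e"
proof -
  note [measurable] = g(1) A(1)
  have [measurable]: "enlargement h A \<in> sets M" for h using open_enlargement[of h A] M by auto
  have [measurable]: "closure A \<in> sets M" using M by simp
  define S where "S j = enlargement (1 / real (Suc j)) A - A" for j
  have [measurable]: "S j \<in> sets M" for j unfolding S_def by measurable
  have "decseq S"
    unfolding S_def by (intro decseq_SucI Diff_mono enlargement_mono divide_left_mono) auto
  moreover have "emeasure (density M g) (S j) \<noteq> \<infinity>" for j
  proof -
    have "emeasure (density M g) (S j) \<le> (\<integral>\<^sup>+x. g x \<partial>M)"
      by (subst emeasure_density) (auto intro!: nn_integral_mono simp: indicator_def)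
    then show ?thesis using g(2) by (auto simp: top_unique)
  qed
  ultimately have "(\<lambda>j. emeasure (density M g) (S j)) \<longlonglongrightarrow> emeasure (density M g) (\<Inter>j. S j)"
    by (intro Lim_emeasure_decseq) auto
  also have "(\<Inter>j. S j) = closure A - A"
    unfolding S_def using Inter_enlargement[of A] by auto
  also have "emeasure (density M g) (closure A - A) = 0"
    using A(2) by (subst emeasure_density) (auto intro!: nn_integral_null_set simp: null_sets_def)
  finally have "\<forall>\<^sub>F j in sequentially. emeasure (density M g) (S j) < e"
    using e by (rule order_tendstoD(2))
  then obtain j where j: "emeasure (density M g) (S j) < e"
    by (auto simp: eventually_sequentially)
  show ?thesis
  proof (intro exI[of _ "1 / real (Suc j)"] conjI allI impI)
    fix h assume h: "h \<le> 1 / real (Suc j)"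
    have "(\<integral>\<^sup>+x. g x * indicator (enlargement h A - A) x \<partial>M) \<le> (\<integral>\<^sup>+x. g x * indicator (S j) x \<partial>M)"
      using enlargement_mono[OF h, of A] unfolding S_def
      by (intro nn_integral_mono mult_left_mono) (auto simp: indicator_def)
    also have "\<dots> < e" using j by (subst (asm) emeasure_density) auto
    finally show "(\<integral>\<^sup>+x. g x * indicator (enlargement h A - A) x \<partial>M) < e" .
  qed simp
qed

text \<open>With \<open>R\<close> and \<open>k\<close> fixed, the limit in \<open>h\<close> removes
  the shell term and leaves the square of the cone integral over \<open>A\<close> on the left and
  one factor of that integral on the right.\<close>

lemma uncertainty_cone_estimate:
  fixes M :: "'a::metric_space measure"
  assumes M: "sets M = sets borel"
    and proper: "\<And>r. compact (cball p r)"
    and A: "A \<in> sets M" "emeasure M A = ennreal \<alpha>" "A \<noteq> {}" and \<alpha>: "0 \<le> \<alpha>"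
    and m: "minkowski_content M A = ennreal m" "0 \<le> m"
    and w: "w \<in> borel_measurable M" "\<And>x. 0 \<le> w x" "\<And>x. x \<in> A \<Longrightarrow> w x \<le> t"
    and w_int: "(\<integral>\<^sup>+x. ennreal (w x * cone p R x) \<partial>M) < \<infinity>"
    and uncertainty: "\<And>f. f \<in> Lip0 \<Longrightarrow>
           (L1_norm M (\<lambda>x. ennreal \<bar>f x\<bar>))\<^sup>2
             \<le> ennreal c * L1_norm M (grad_norm f) * L1_norm M (\<lambda>x. ennreal \<bar>w x * f x\<bar>)"
    and c: "0 \<le> c" and R: "0 < R" and k: "1 < k"
  shows "(\<integral>\<^sup>+x. ennreal (cone p R x) * indicator A x \<partial>M) \<le> ennreal (c * t * (k * m + \<alpha> / R))"
proof -
  have t: "0 \<le> t" using A(3) w(2,3) by (meson ex_in_conv order_trans)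
  define P where "P = (\<integral>\<^sup>+x. ennreal (cone p R x) * indicator A x \<partial>M)"
  have "P \<le> (\<integral>\<^sup>+x. indicator A x \<partial>M)"
    unfolding P_def using cone_bounds(2)[OF R, of p] by (intro nn_integral_mono) (auto simp: indicator_def)
  \<comment> \<open>Finiteness of \<open>P\<close> is what permits passing to real numbers and later
    cancelling it.\<close>
  also have "\<dots> = ennreal \<alpha>" using A by simp
  finally obtain P' where P': "P = ennreal P'" "0 \<le> P'"
    by (cases P) (auto simp: top_unique)
  have meas: "(\<lambda>x. ennreal (w x * cone p R x)) \<in> borel_measurable M"
    using borel_measurable_cone[OF M R, of p] w(1) by measurable
  have null: "emeasure M (closure A - A) = 0"
    using emeasure_closure_diff_eq_0[OF M A(1)] A(2) m(1) by simp
  \<comment> \<open>One parameter \<delta> bounds three errors: the excess of the quotient over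
    \<open>m\<close>, the size of \<open>h\<close>, and the integral of the weighted cone over the
    shell. The resulting inequality no longer mentions \<open>h\<close>.\<close>
  have le: "P'\<^sup>2 \<le> c * (k * (m + \<delta>) + 1 / R * (\<alpha> + \<delta> * (m + \<delta>))) * (t * P' + \<delta>)"
    if \<delta>: "0 < \<delta>" for \<delta>
  proof -
    obtain \<eta> where \<eta>: "0 < \<eta>" and E: "\<And>h. h \<le> \<eta> \<Longrightarrow>
        (\<integral>\<^sup>+x. ennreal (w x * cone p R x) * indicator (enlargement h A - A) x \<partial>M) < ennreal \<delta>"
      using ex_nn_integral_enlargement_less[OF M A(1) null meas w_int, of "ennreal \<delta>"] \<delta> by auto
    have "minkowski_content M A < ennreal (m + \<delta>)" using m \<delta> by (simp add: ennreal_less_iff)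
    then obtain h where h: "0 < h" "h < min \<delta> \<eta>"
      and q: "(emeasure M (enlargement h A) - emeasure M A) / ennreal h < ennreal (m + \<delta>)"
      using ex_quotient_less[of M A _ "min \<delta> \<eta>"] \<delta> \<eta> by auto
    have "P\<^sup>2 \<le> ennreal c * (ennreal k * ((emeasure M (enlargement h A) - emeasure M A) / ennreal h)
        + ennreal (1 / R) * (emeasure M A + ennreal h * ((emeasure M (enlargement h A) - emeasure M A) / ennreal h)))
      * (ennreal t * P + (\<integral>\<^sup>+x. ennreal (w x * cone p R x) * indicator (enlargement h A - A) x \<partial>M))"
      unfolding P_def using A
      by (intro uncertainty_collar_estimate[OF M proper A(1) _ A(3) w uncertainty R k h(1)]) auto
    also have "\<dots> \<le> ennreal c * (ennreal k * ennreal (m + \<delta>)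
        + ennreal (1 / R) * (ennreal \<alpha> + ennreal \<delta> * ennreal (m + \<delta>)))
      * (ennreal t * P + ennreal \<delta>)"
      using q E[of h] h A(2) by (intro mult_mono add_mono order_refl) (auto intro: ennreal_leI)
    also have "\<dots> = ennreal (c * (k * (m + \<delta>) + 1 / R * (\<alpha> + \<delta> * (m + \<delta>))) * (t * P' + \<delta>))"
    proof -
      have "0 \<le> k * (m + \<delta>)" "0 \<le> \<delta> * (m + \<delta>)" "0 \<le> t * P'" "0 \<le> 1 / R" "0 \<le> k"
        using k m \<delta> t P' R by auto
      then show ?thesis
        using c \<alpha> \<delta> m(2) t P'(2) unfolding P'(1)
        by (simp only: ennreal_mult[symmetric] ennreal_plus[symmetric] add_nonneg_nonneg
            mult_nonneg_nonneg less_imp_le)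
    qed
    finally have "ennreal (P'\<^sup>2) \<le> \<dots>" using P' by (simp add: ennreal_power)
    moreover have "0 \<le> c * (k * (m + \<delta>) + 1 / R * (\<alpha> + \<delta> * (m + \<delta>))) * (t * P' + \<delta>)"
      using c \<alpha> \<delta> m(2) t P'(2) k R by (intro mult_nonneg_nonneg add_nonneg_nonneg) auto
    ultimately show ?thesis by (simp add: ennreal_le_iff)
  qed
  have "((\<lambda>\<delta>. c * (k * (m + \<delta>) + 1 / R * (\<alpha> + \<delta> * (m + \<delta>))) * (t * P' + \<delta>))
      \<longlongrightarrow> c * (k * (m + 0) + 1 / R * (\<alpha> + 0 * (m + 0))) * (t * P' + 0)) (at_right 0)"
    by (intro tendsto_intros)
  moreover have "\<forall>\<^sub>F \<delta> in at_right 0.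
      P'\<^sup>2 \<le> c * (k * (m + \<delta>) + 1 / R * (\<alpha> + \<delta> * (m + \<delta>))) * (t * P' + \<delta>)"
    using eventually_at_right_less[of "0::real"] by eventually_elim (rule le)
  ultimately have "P'\<^sup>2 \<le> c * (k * (m + 0) + 1 / R * (\<alpha> + 0 * (m + 0))) * (t * P' + 0)"
    by (rule tendsto_lowerbound) simp
  then have "P' * P' \<le> c * t * (k * m + \<alpha> / R) * P'"
    by (simp add: power2_eq_square algebra_simps)
  moreover have "0 \<le> c * t * (k * m + \<alpha> / R)"
    using c t k m \<alpha> R by auto
  \<comment> \<open>For \<open>P' = 0\<close> the claim is nonnegativity of the right-hand side;
    otherwise the common factor \<open>P'\<close> cancels.\<close>
  ultimately have "P' \<le> c * t * (k * m + \<alpha> / R)"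
    using P'(2) by (cases "P' = 0") (auto simp: mult_le_cancel_right)
  then show ?thesis using P' unfolding P_def by (auto intro: ennreal_leI)
qed

section \<open>Finiteness of the weighted cone integral, nonvanishing of the constant, and the
  conclusion\<close>

lemma nn_integral_weight_cone_finite:
  assumes M: "sets M = sets borel" and w: "weight M w" and K: "compact (cball p R)" and R: "0 < R"
  shows "(\<integral>\<^sup>+x. ennreal (w x * cone p R x) \<partial>M) < \<infinity>"
proof -
  have int: "integrable M (\<lambda>x. indicator (cball p R) x * w x)"
    using w K unfolding weight_def set_integrable_def by auto
  have "(\<integral>\<^sup>+x. ennreal (w x * cone p R x) \<partial>M) \<le> (\<integral>\<^sup>+x. ennreal (norm (indicator (cball p R) x * w x)) \<partial>M)"
  proof (intro nn_integral_mono ennreal_leI)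
    fix x
    have "0 \<le> w x" using w by (simp add: weight_def)
    then show "w x * cone p R x \<le> norm (indicator (cball p R) x * w x)"
      using cone_bounds(2)[OF R, of p x] cone_eq_0[OF R, of x p]
      by (cases "x \<in> cball p R") (auto simp: mult_left_le)
  qed
  also have "\<dots> < \<infinity>" using int unfolding integrable_iff_bounded by simp
  finally show ?thesis .
qed

text \<open>If the constant were 0, the right-hand side would vanish even for infinite norms, since
  \<open>0 * \<infinity> = 0\<close> in \<open>ennreal\<close>. All cones would then have integral
  0, and their monotone limit 1 would give the space measure 0.\<close>

lemma uncertainty_constant_nonzero:
  fixes M :: "'a::metric_space measure"
  assumes M: "sets M = sets borel"
    and proper: "\<And>(x::'a) r. compact (cball x r)"
    and nz: "emeasure M UNIV \<noteq> 0"
    and uncertainty: "\<And>f. f \<in> Lip0 \<Longrightarrow>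
           (L1_norm M (\<lambda>x. ennreal \<bar>f x\<bar>))\<^sup>2
             \<le> ennreal c * L1_norm M (grad_norm f) * L1_norm M (\<lambda>x. ennreal \<bar>w x * f x\<bar>)"
  shows "ennreal c \<noteq> 0"
proof
  assume c: "ennreal c = 0"
  fix p :: 'a
  have 0: "(\<integral>\<^sup>+x. ennreal (cone p (real (Suc n)) x) * indicator UNIV x \<partial>M) = 0" for n
  proof -
    \<comment> \<open>Since \<open>infdist x {} = 0\<close>, the collar of the empty set is
      constantly 1, so the minimum is the cone itself and membership in \<open>Lip0\<close> is
      inherited.\<close>
    have "(\<lambda>x. min (collar 1 2 {} x) (cone p (real (Suc n)) x)) \<in> Lip0"
      by (intro min_collar_cone_Lip0 proper) auto
    moreover have "min (collar 1 2 {} x) (cone p (real (Suc n)) x) = cone p (real (Suc n)) x" for x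
      using collar_eq_1[of 1 2 x "{}"] cone_bounds(2)[of "real (Suc n)" p x]
      by (simp add: infdist_def)
    ultimately have "cone p (real (Suc n)) \<in> Lip0" by simp
    from uncertainty[OF this] show ?thesis
      by (simp add: c L1_norm_def cone_bounds)
  qed
  have "emeasure M UNIV = 0"
    using nn_integral_cone_tendsto[OF M, of UNIV p] M unfolding 0
    by (simp add: LIMSEQ_const_iff)
  with nz show False by simp
qed

theorem mainTheorem10:
  fixes \<mu> :: "'a::metric_space measure"
    and w :: "'a \<Rightarrow> real"
    and c t :: real
  assumes borel: "sets \<mu> = sets borel"
    and connected: "connected (UNIV :: 'a set)"
    and proper: "\<And>(x::'a) r. compact (cball x r)"
    and finite_on_compacts: "\<And>K. compact K \<Longrightarrow> emeasure \<mu> K < \<infinity>"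
    and infinite_measure: "emeasure \<mu> UNIV = \<infinity>"
    and profile: "standard_profile (isop_profile \<mu>)"
    and weight: "weight \<mu> w"
    and c_nonneg: "0 \<le> c"
    and uncertainty: "\<And>f. f \<in> Lip0 \<Longrightarrow>
           (L1_norm \<mu> (\<lambda>x. ennreal \<bar>f x\<bar>))\<^sup>2
             \<le> ennreal c * L1_norm \<mu> (grad_norm f) * L1_norm \<mu> (\<lambda>x. ennreal \<bar>w x * f x\<bar>)"
    and t_pos: "0 < t"
    and finite_level: "emeasure \<mu> {x. w x \<le> t} < \<infinity>"
  shows "emeasure \<mu> {x. w x \<le> t}
           \<le> ennreal c * ennreal t * minkowski_content \<mu> {x. w x \<le> t}"
proof -
  define A where "A = {x. w x \<le> t}"
  have w: "w \<in> borel_measurable \<mu>" "\<And>x. 0 \<le> w x" using weight by (auto simp: weight_def)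
  have "space \<mu> = UNIV" using sets_eq_imp_space_eq[OF borel] by simp
  then have A: "A \<in> sets \<mu>" unfolding A_def using measurable_sets[OF w(1), of "{..t}"]
    by (simp add: vimage_def)
  have "emeasure \<mu> A \<le> ennreal c * ennreal t * minkowski_content \<mu> A"
  \<comment> \<open>The empty set is treated apart because the distance to it takes the default
    value 0, so its collar would not vanish off its enlargement.\<close>
  proof (cases "A = {} \<or> minkowski_content \<mu> A = \<infinity>")
    case True
    have "ennreal c \<noteq> 0"
      using infinite_measure by (intro uncertainty_constant_nonzero[OF borel proper _ uncertainty]) auto
    then show ?thesis using True t_pos by (auto simp: ennreal_mult_top ennreal_mult_eq_top_iff)
  next
    case False
    then obtain p m where p: "p \<in> A" and m: "minkowski_content \<mu> A = ennreal m" "0 \<le> m"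
      by (cases "minkowski_content \<mu> A") auto
    obtain \<alpha> where \<alpha>: "emeasure \<mu> A = ennreal \<alpha>" "0 \<le> \<alpha>"
      using finite_level by (cases "emeasure \<mu> A") (auto simp: A_def)
    have lim: "(\<lambda>n. y / real (Suc n)) \<longlonglongrightarrow> 0" for y :: real
      by (rule LIMSEQ_Suc[OF lim_const_over_n])
    \<comment> \<open>The choices \<open>R = Suc n\<close> and \<open>k = 1 + 1 / Suc n\<close> let
      the cone slope and the margin loss disappear in a single limit.\<close>
    have "(\<integral>\<^sup>+x. ennreal (cone p (real (Suc n)) x) * indicator A x \<partial>\<mu>)
        \<le> ennreal (c * t * ((1 + 1 / real (Suc n)) * m + \<alpha> / real (Suc n)))" for n
      using False
      by (intro uncertainty_cone_estimate[OF borel proper A \<alpha>(1) _ \<alpha>(2) m w _ _ uncertainty c_nonneg]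
          nn_integral_weight_cone_finite borel weight proper) (auto simp: A_def)
    moreover have "(\<lambda>n. ennreal (c * t * ((1 + 1 / real (Suc n)) * m + \<alpha> / real (Suc n))))
        \<longlonglongrightarrow> ennreal (c * t * ((1 + 0) * m + 0))"
      by (rule tendsto_ennrealI tendsto_mult tendsto_add tendsto_const lim)+
    ultimately have "emeasure \<mu> A \<le> ennreal (c * t * ((1 + 0) * m + 0))"
      using nn_integral_cone_tendsto[OF borel A, of p] by (intro LIMSEQ_le) auto
    also have "\<dots> = ennreal c * ennreal t * minkowski_content \<mu> A"
      using c_nonneg t_pos m by (simp add: ennreal_mult)
    finally show ?thesis .
  qed
  then show ?thesis unfolding A_def .
qed

end
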